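(* Let $3\le m\le n$ and let $\mathbf a_1,\dots,\mathbf a_m\in\mathbb R^n$ be non-zero-variance vectors. Then $$r_{\mathbf a_1\mathbf a_2\cdots\mathbf a_m}^2\ \ge\ r_{\mathbf a_1\mathbf a_2\cdots\mathbf a_{m-1}}^2\qquad\text{and}\qquad \omega_{\mathbf a_1\mathbf a_2\cdots\mathbf a_m}^2\ \le\ \omega_{\mathbf a_1\mathbf a_2\cdots\mathbf a_{m-1}}^2 .$$
   Context: For $\mathbf a=(a_1,\dots,a_n)^T\in\mathbb R^n$ let $\mu_{\mathbf a}=\frac1n\sum_{i=1}^n a_i$ and let $\mathbf 1$ be the all-ones vector; $\mathbf a$ is a non-zero-variance vector if $\mathbf a-\mu_{\mathbf a}\mathbf 1\neq 0$. In that case its standardized vector is $\mathbf a'=\frac{\mathbf a-\mu_{\mathbf a}\mathbf 1}{\|\mathbf a-\mu_{\mathbf a}\mathbf 1\|}$ (Euclidean norm). For non-zero-variance vectors $\mathbf a_1,\dots,\mathbf a_k\in\mathbb R^n$ ($2\le k\le n$) with standardized vectors $\mathbf a_i'=(a'_{i1},\dots,a'_{in})^T$, and for $1\le j_1<\cdots<j_k\le n$, let $[\mathbf a'(k)\,|\,j_1,\dots,j_k]$ be the $k\times k$ matrix with $(i,l)$ entry $a'_{i j_l}$. The unsigned incorrelation coefficient $\omega_{\mathbf a_1\cdots\mathbf a_k}\ge0$ and the unsigned correlation coefficient $r_{\mathbf a_1\cdots\mathbf a_k}\ge 0$ are defined by $$\omega_{\mathbf a_1\cdots\mathbf a_k}^2=\sum_{1\le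 j_1<\cdots<j_k\le n}\bigl(\det[\mathbf a'(k)\,|\,j_1,\dots,j_k]\bigr)^2,\qquad r_{\mathbf a_1\cdots\mathbf a_k}^2=1-\omega_{\mathbf a_1\cdots\mathbf a_k}^2 .$$ *)

theory Defs
  imports Complex_Main "Jordan_Normal_Form.Determinant"
begin

definition vec_mean :: "real vec \<Rightarrow> real" where
  "vec_mean a = (1 / real (dim_vec a)) * (\<Sum>i<dim_vec a. a $ i)"

definition all_ones_vec :: "nat \<Rightarrow> real vec" where
  "all_ones_vec n = vec n (\<lambda>_. 1)"

definition centered_vec :: "real vec \<Rightarrow> real vec" where
  "centered_vec a = a - vec_mean a \<cdot>\<^sub>v all_ones_vec (dim_vec a)"

definition euclidean_norm :: "real vec \<Rightarrow> real" where
  "euclidean_norm v = sqrt (\<Sum>i<dim_vec v. (v $ i)\<^sup>2)"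

definition nonzero_variance :: "real vec \<Rightarrow> bool" where
  "nonzero_variance a \<longleftrightarrow> centered_vec a \<noteq> 0\<^sub>v (dim_vec a)"

definition standardized_vec :: "real vec \<Rightarrow> real vec" where
  "standardized_vec a = (1 / euclidean_norm (centered_vec a)) \<cdot>\<^sub>v centered_vec a"

(* Families a_1, ..., a_k are lists; rows, columns and coordinates are numbered from 0,
   so a choice 1 <= j_1 < ... < j_k <= n is a strictly increasing list over {..<n}. *)
definition column_choices :: "nat \<Rightarrow> nat \<Rightarrow> nat list set" where
  "column_choices n k = {js. length js = k \<and> sorted_wrt (<) js \<and> set js \<subseteq> {..<n}}"

definition standardized_submatrix :: "real vec list \<Rightarrow> nat list \<Rightarrow> real mat" where
  "standardized_submatrix as js =
     mat (length as) (length as) (\<lambda>(i, l). standardized_vec (as ! i) $ (js ! l))"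

definition unsigned_incorrelation :: "nat \<Rightarrow> real vec list \<Rightarrow> real" where
  "unsigned_incorrelation n as =
     sqrt (\<Sum>js\<in>column_choices n (length as). (det (standardized_submatrix as js))\<^sup>2)"

(* The radicand is nonnegative for 2 <= k <= n non-zero-variance vectors in R^n, so this is
   the r >= 0 with r^2 = 1 - omega^2; for negative x, HOL's sqrt x is - sqrt (- x). *)
definition unsigned_correlation :: "nat \<Rightarrow> real vec list \<Rightarrow> real" where
  "unsigned_correlation n as = sqrt (1 - (unsigned_incorrelation n as)\<^sup>2)"

end

(* Let w be the wedge product of the first k standardized vectors, whose coordinates are the
   k x k minors, so that omega^2 = |w|^2. Laplace expansion along the last row shows that
   appending a vector b replaces w by its wedge with b, and the Clifford relation
   |b wedge w|^2 + |i_b w|^2 = |b|^2 |w|^2 (i_b the contraction by b) gives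
   |b wedge w| <= |w| for |b| <= 1. Going down to the empty family, where |w| = 1, this also
   shows omega^2 <= 1, so that the radicand in the definition of r is nonnegative. *)
theory Submission
  imports Defs
begin

section \<open>Wedge and contraction for functions on index sets\<close>

text \<open>The exterior algebra is modelled as functions on sets of indices. Counting the elements
  above \<open>j\<close> corresponds to appending \<open>b\<close> as the last factor, hence to
  the last row of a minor.\<close>

definition wedge :: "(nat \<Rightarrow> real) \<Rightarrow> (nat set \<Rightarrow> real) \<Rightarrow> nat set \<Rightarrow> real" where
  "wedge b f J = (\<Sum>j\<in>J. (- 1) ^ card {y \<in> J. j < y} * b j * f (J - {j}))"

text \<open>The adjoint of \<open>wedge b\<close> for the inner product that sums over
  \<open>Pow N\<close>. For \<open>j\<close> outside \<open>T\<close> the elements above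
  \<open>j\<close> are the same in \<open>T\<close> and in \<open>insert j T\<close>, so the sign is
  the one with which \<open>wedge\<close> takes \<open>j\<close> out of
  \<open>insert j T\<close>.\<close>

definition contract :: "nat set \<Rightarrow> (nat \<Rightarrow> real) \<Rightarrow> (nat set \<Rightarrow> real) \<Rightarrow> nat set \<Rightarrow> real" where
  "contract N b f T = (\<Sum>j\<in>N - T. (- 1) ^ card {y \<in> T. j < y} * b j * f (insert j T))"

lemma sum_Pow_insert:
  fixes F :: "'a set \<Rightarrow> 'b :: comm_monoid_add"
  assumes "finite N" "x \<notin> N"
  shows "(\<Sum>J\<in>Pow (insert x N). F J) = (\<Sum>J\<in>Pow N. F J) + (\<Sum>J\<in>Pow N. F (insert x J))"
proof -
  have inj: "inj_on (insert x) (Pow N)"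
    using assms(2) by (auto simp: inj_on_def)
  show ?thesis
    unfolding Pow_insert using assms
    by (subst sum.union_disjoint) (auto simp: sum.reindex[OF inj])
qed

lemma sign_insert_greater:
  assumes "finite J" "j < x" "x \<notin> J"
  shows "(- 1 :: real) ^ card {y \<in> insert x J. j < y} = - ((- 1) ^ card {y \<in> J. j < y})"
proof -
  have "{y \<in> insert x J. j < y} = insert x {y \<in> J. j < y}"
    using assms(2) by auto
  then show ?thesis using assms by simp
qed

text \<open>Nothing lies above \<open>x\<close>, so taking out \<open>x\<close> has sign +1; for any
  other index the presence of \<open>x\<close> above it flips the sign. This is the recursion for
  inductions that add a new maximum.\<close>

lemma wedge_insert_greater:
  assumes "finite J" "\<And>j. j \<in> J \<Longrightarrow> j < x"
  shows "wedge b f (insert x J) = b x * f J - wedge b (\<lambda>S. f (insert x S)) J"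
proof -
  have x: "x \<notin> J" using assms(2) by blast
  have none: "{y \<in> insert x J. x < y} = {}"
    using assms(2) by force
  have "(\<Sum>j\<in>J. (- 1) ^ card {y \<in> insert x J. j < y} * b j * f (insert x J - {j}))
      = (\<Sum>j\<in>J. - ((- 1) ^ card {y \<in> J. j < y} * b j * f (insert x (J - {j}))))"
  proof (rule sum.cong[OF refl])
    fix j assume j: "j \<in> J"
    have "insert x J - {j} = insert x (J - {j})" using j x by auto
    then show "(- 1) ^ card {y \<in> insert x J. j < y} * b j * f (insert x J - {j})
        = - ((- 1) ^ card {y \<in> J. j < y} * b j * f (insert x (J - {j})))"
      using sign_insert_greater[OF assms(1) assms(2)[OF j] x] by simp
  qed
  then show ?thesis
    unfolding wedge_def sum.insert[OF assms(1) x] none using x by (simp add: sum_negf)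
qed

text \<open>The counterpart for \<open>contract\<close>: a set without \<open>x\<close> can also
  receive \<open>x\<close>, with sign +1, while a set with \<open>x\<close> receives only indices
  below it, each with flipped sign.\<close>

lemma contract_insert_greater:
  assumes "finite N" "\<And>j. j \<in> N \<Longrightarrow> j < x" "T \<subseteq> N"
  shows "contract (insert x N) b f T = b x * f (insert x T) + contract N b f T"
    and "contract (insert x N) b f (insert x T) = - contract N b (\<lambda>S. f (insert x S)) T"
proof -
  have x: "x \<notin> N" "x \<notin> T" using assms(2,3) by blast+
  have "insert x N - T = insert x (N - T)" using x by auto
  moreover have none: "{y \<in> T. x < y} = {}" using assms(2,3) by force
  ultimately show "contract (insert x N) b f T = b x * f (insert x T) + contract N b f T"
    unfolding contract_def using assms(1) x by (simp del: Collect_empty_eq add: none)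
  have "insert x N - insert x T = N - T" using x by auto
  moreover have "(- 1) ^ card {y \<in> insert x T. j < y} * b j * f (insert j (insert x T))
      = - ((- 1) ^ card {y \<in> T. j < y} * b j * f (insert x (insert j T)))"
    if "j \<in> N - T" for j
    using sign_insert_greater[of T j x] assms that x(2) finite_subset[OF assms(3,1)]
    by (simp add: insert_commute)
  ultimately show "contract (insert x N) b f (insert x T) = - contract N b (\<lambda>S. f (insert x S)) T"
    unfolding contract_def by (simp add: sum_negf)
qed

text \<open>Makes the mixed terms of the norm identity cancel. Splitting the subsets by whether they
  contain the maximum \<open>x\<close> yields the same \<open>b x\<close> terms on both sides; the
  rest is the induction hypothesis for \<open>f\<close>, \<open>h\<close> and for their shifts by
  \<open>x\<close>, which is why both functions are arbitrary.\<close>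

lemma wedge_contract_adjoint:
  assumes "finite N"
  shows "(\<Sum>J\<in>Pow N. wedge b f J * h J) = (\<Sum>J\<in>Pow N. f J * contract N b h J)"
  using assms
proof (induction N arbitrary: f h rule: finite_linorder_max_induct)
  case empty
  then show ?case by (simp add: wedge_def contract_def)
next
  case (insert x N)
  let ?g = "\<lambda>S. f (insert x S)" and ?k = "\<lambda>S. h (insert x S)"
  have x: "x \<notin> N" using insert.hyps(2) by blast
  have w: "wedge b f (insert x J) = b x * f J - wedge b ?g J" if "J \<in> Pow N" for J
    using that insert.hyps by (intro wedge_insert_greater) (auto intro: finite_subset)
  have c: "contract (insert x N) b h J = b x * ?k J + contract N b h J"
      "contract (insert x N) b h (insert x J) = - contract N b ?k J" if "J \<in> Pow N" for J
    using that insert.hyps by (intro contract_insert_greater; auto)+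
  have "(\<Sum>J\<in>Pow (insert x N). wedge b f J * h J)
      = (\<Sum>J\<in>Pow N. wedge b f J * h J)
        + (\<Sum>J\<in>Pow N. b x * f J * ?k J - wedge b ?g J * ?k J)"
    by (simp add: sum_Pow_insert[OF insert.hyps(1) x] w algebra_simps)
  also have "\<dots> = (\<Sum>J\<in>Pow N. f J * contract N b h J)
      + (\<Sum>J\<in>Pow N. b x * f J * ?k J) - (\<Sum>J\<in>Pow N. ?g J * contract N b ?k J)"
    by (simp only: insert.IH sum_subtractf)
  also have "\<dots> = (\<Sum>J\<in>Pow (insert x N). f J * contract (insert x N) b h J)"
    by (simp add: sum_Pow_insert[OF insert.hyps(1) x] c sum.distrib sum_negf algebra_simps)
  finally show ?case .
qed

text \<open>The Clifford relation paired with \<open>f\<close>, by the same splitting at the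
  maximum; \<open>f\<close> may mix sets of different sizes.\<close>

lemma wedge_contract_norm:
  assumes "finite N"
  shows "(\<Sum>J\<in>Pow N. (wedge b f J)\<^sup>2) + (\<Sum>J\<in>Pow N. (contract N b f J)\<^sup>2)
       = (\<Sum>j\<in>N. (b j)\<^sup>2) * (\<Sum>J\<in>Pow N. (f J)\<^sup>2)"
  using assms
proof (induction N arbitrary: f rule: finite_linorder_max_induct)
  case empty
  then show ?case by (simp add: wedge_def contract_def)
next
  case (insert x N)
  let ?g = "\<lambda>S. f (insert x S)"
  have x: "x \<notin> N" using insert.hyps(2) by blast
  have w: "wedge b f (insert x J) = b x * f J - wedge b ?g J" if "J \<in> Pow N" for J
    using that insert.hyps by (intro wedge_insert_greater) (auto intro: finite_subset)
  have c: "contract (insert x N) b f J = b x * ?g J + contract N b f J"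
      "contract (insert x N) b f (insert x J) = - contract N b ?g J" if "J \<in> Pow N" for J
    using that insert.hyps by (intro contract_insert_greater; auto)+
  have W: "(\<Sum>J\<in>Pow (insert x N). (wedge b f J)\<^sup>2)
      = (\<Sum>J\<in>Pow N. (wedge b f J)\<^sup>2) + (b x)\<^sup>2 * (\<Sum>J\<in>Pow N. (f J)\<^sup>2)
        + (\<Sum>J\<in>Pow N. (wedge b ?g J)\<^sup>2) - 2 * b x * (\<Sum>J\<in>Pow N. wedge b ?g J * f J)"
    by (simp add: sum_Pow_insert[OF insert.hyps(1) x] w power2_diff power_mult_distrib
        sum.distrib sum_subtractf sum_distrib_left mult_ac)
  have C: "(\<Sum>J\<in>Pow (insert x N). (contract (insert x N) b f J)\<^sup>2)
      = (\<Sum>J\<in>Pow N. (contract N b f J)\<^sup>2) + (b x)\<^sup>2 * (\<Sum>J\<in>Pow N. (?g J)\<^sup>2)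
        + (\<Sum>J\<in>Pow N. (contract N b ?g J)\<^sup>2) + 2 * b x * (\<Sum>J\<in>Pow N. ?g J * contract N b f J)"
    by (simp add: sum_Pow_insert[OF insert.hyps(1) x] c power2_sum power_mult_distrib
        sum.distrib sum_distrib_left mult_ac)
  \<comment> \<open>By adjointness the mixed terms of \<open>W\<close> and \<open>C\<close> are
    opposite. The terms with the square of \<open>b x\<close> combine to the norm of
    \<open>f\<close> on the larger power set, and the induction hypotheses for \<open>f\<close> and
    \<open>?g\<close> give the rest.\<close>
  show ?case
    unfolding W C wedge_contract_adjoint[OF insert.hyps(1)]
      sum_Pow_insert[OF insert.hyps(1) x] sum.insert[OF insert.hyps(1) x]
    using insert.IH[of f] insert.IH[of ?g] by (simp add: algebra_simps)
qed

section \<open>Minors as coordinates of a wedge product\<close>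

definition minor :: "(nat \<Rightarrow> nat \<Rightarrow> real) \<Rightarrow> nat \<Rightarrow> nat set \<Rightarrow> real" where
  "minor r k J = det (mat k k (\<lambda>(i, l). r i (sorted_list_of_set J ! l)))"

text \<open>Translates the deleted columns of the Laplace expansion into the removal of an index in
  \<open>wedge\<close>.\<close>

lemma sorted_list_of_set_remove_nth:
  assumes "finite J" "l < card J"
  shows "sorted_list_of_set (J - {sorted_list_of_set J ! l})
       = take l (sorted_list_of_set J) @ drop (Suc l) (sorted_list_of_set J)"
proof -
  let ?xs = "sorted_list_of_set J"
  have l: "l < length ?xs" using assms by simp
  have split: "?xs = take l ?xs @ ?xs ! l # drop (Suc l) ?xs"
    using l by (rule id_take_nth_drop)
  have "?xs ! l \<notin> set (take l ?xs)"
    using l distinct_sorted_list_of_set[of J] split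
    by (metis disjoint_iff distinct_append list.set_intros(1))
  then have "remove1 (?xs ! l) ?xs = take l ?xs @ drop (Suc l) ?xs"
    using split by (metis remove1_append remove1.simps(2))
  then show ?thesis
    using assms(1) by (simp add: sorted_list_of_set_remove)
qed

text \<open>Supplies the cofactor signs. Positions count from 0, so \<open>Suc l\<close> elements
  are not above the one at position \<open>l\<close>.\<close>

lemma card_greater_nth_sorted_list_of_set:
  assumes "finite J" "l < card J"
  shows "card {y \<in> J. sorted_list_of_set J ! l < y} = card J - Suc l"
proof -
  let ?xs = "sorted_list_of_set J"
  have len: "length ?xs = card J" using assms by simp
  have strict: "sorted_wrt (<) ?xs" by simp
  have eq: "{y \<in> J. ?xs ! l < y} = (!) ?xs ` {Suc l..<card J}"
  proof (intro equalityI subsetI)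
    fix y assume "y \<in> {y \<in> J. ?xs ! l < y}"
    then have y: "y \<in> set ?xs" "?xs ! l < y" using assms(1) by auto
    then obtain i where i: "i < card J" "y = ?xs ! i"
      by (metis in_set_conv_nth len)
    have "l < i"
      using y(2) i assms(2) len strict
      by (metis linorder_neqE_nat order_less_asym sorted_wrt_nth_less)
    then show "y \<in> (!) ?xs ` {Suc l..<card J}" using i by auto
  next
    fix y assume "y \<in> (!) ?xs ` {Suc l..<card J}"
    then obtain i where i: "l < i" "i < card J" "y = ?xs ! i"
      by (auto simp: Suc_le_eq)
    then show "y \<in> {y \<in> J. ?xs ! l < y}"
      using strict len assms(1) sorted_wrt_nth_less[OF strict i(1)] nth_mem[of i ?xs] by auto
  qed
  have "inj_on ((!) ?xs) {Suc l..<card J}"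
    using len by (auto simp: inj_on_def nth_eq_iff_index_eq)
  then show ?thesis unfolding eq by (simp add: card_image)
qed

text \<open>Laplace expansion along the last row, whose entries come from \<open>r k\<close>; the
  column positions \<open>l\<close> are then exchanged for the elements of \<open>J\<close>.\<close>

lemma minor_Suc:
  assumes "card J = Suc k"
  shows "minor r (Suc k) J = wedge (r k) (minor r k) J"
proof -
  have fin: "finite J" using assms card.infinite by fastforce
  let ?xs = "sorted_list_of_set J"
  let ?A = "mat (Suc k) (Suc k) (\<lambda>(i, l). r i (?xs ! l))"
  have len: "length ?xs = Suc k" using assms by simp
  have del: "det (mat_delete ?A k l) = minor r k (J - {?xs ! l})" if "l < Suc k" for l
  proof -
    have "mat_delete ?A k l = mat k k (\<lambda>(i, l'). r i (sorted_list_of_set (J - {?xs ! l}) ! l'))"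
      unfolding mat_delete_def
      using that len sorted_list_of_set_remove_nth[OF fin, of l] assms
      by (intro eq_matI) (auto simp: nth_append min_def)
    then show ?thesis unfolding minor_def by simp
  qed
  \<comment> \<open>There are \<open>k - l\<close> elements above position \<open>l\<close>, and
    this has the parity of \<open>k + l\<close>.\<close>
  have sign: "(- 1 :: real) ^ (k + l) = (- 1) ^ card {y \<in> J. ?xs ! l < y}" if "l < Suc k" for l
  proof -
    have "k + l = (k - l) + 2 * l" using that by simp
    then have "(- 1 :: real) ^ (k + l) = (- 1) ^ (k - l)"
      by (simp only: power_add power_mult) simp
    then show ?thesis
      using card_greater_nth_sorted_list_of_set[OF fin, of l] that assms by simp
  qed
  have bij: "bij_betw ((!) ?xs) {..<Suc k} J"
    using bij_betw_nth[of ?xs "{..<Suc k}" J] len fin by simp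
  have "minor r (Suc k) J = (\<Sum>l<Suc k. ?A $$ (k, l) * cofactor ?A k l)"
    unfolding minor_def by (rule laplace_expansion_row) auto
  also have "\<dots> = (\<Sum>l<Suc k. (- 1) ^ card {y \<in> J. ?xs ! l < y} * r k (?xs ! l)
      * minor r k (J - {?xs ! l}))"
    by (rule sum.cong[OF refl]) (simp add: cofactor_def del sign)
  also have "\<dots> = wedge (r k) (minor r k) J"
    unfolding wedge_def by (rule sum.reindex_bij_betw[OF bij])
  finally show ?thesis .
qed

text \<open>Obtained from the norm identity by discarding the contraction term.\<close>

lemma sum_minor_square_Suc_le:
  assumes "finite N"
  shows "(\<Sum>J | J \<subseteq> N \<and> card J = Suc k. (minor r (Suc k) J)\<^sup>2)
       \<le> (\<Sum>j\<in>N. (r k j)\<^sup>2) * (\<Sum>J | J \<subseteq> N \<and> card J = k. (minor r k J)\<^sup>2)"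
proof -
  \<comment> \<open>The norm identity sums over all subsets, so the minors are cut off to sets of
    size \<open>k\<close>. For \<open>card J = Suc k\<close>, \<open>wedge\<close> reads only such
    sets.\<close>
  define f where "f J = (if card J = k then minor r k J else 0)" for J
  have "wedge (r k) f J = minor r (Suc k) J" if "card J = Suc k" for J
    unfolding minor_Suc[OF that] wedge_def f_def using that
    by (intro sum.cong) (auto simp: card_Diff_singleton)
  then have "(\<Sum>J | J \<subseteq> N \<and> card J = Suc k. (minor r (Suc k) J)\<^sup>2)
      = (\<Sum>J | J \<subseteq> N \<and> card J = Suc k. (wedge (r k) f J)\<^sup>2)"
    by simp
  also have "\<dots> \<le> (\<Sum>J\<in>Pow N. (wedge (r k) f J)\<^sup>2)"
    using assms by (intro sum_mono2) auto
  also have "\<dots> \<le> (\<Sum>j\<in>N. (r k j)\<^sup>2) * (\<Sum>J\<in>Pow N. (f J)\<^sup>2)"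
    unfolding wedge_contract_norm[OF assms, symmetric] by (simp add: sum_nonneg)
  also have "(\<Sum>J\<in>Pow N. (f J)\<^sup>2) = (\<Sum>J | J \<subseteq> N \<and> card J = k. (minor r k J)\<^sup>2)"
    using assms by (intro sum.mono_neutral_cong_right) (auto simp: f_def)
  finally show ?thesis .
qed

section \<open>Column choices, standardized vectors and the coefficients\<close>

lemma bij_betw_column_choices:
  "bij_betw sorted_list_of_set {J. J \<subseteq> {..<n} \<and> card J = k} (column_choices n k)"
proof (rule bij_betw_byWitness[where f' = set])
  show "\<forall>J\<in>{J. J \<subseteq> {..<n} \<and> card J = k}. set (sorted_list_of_set J) = J"
    by (auto simp: finite_subset)
  show "\<forall>js\<in>column_choices n k. sorted_list_of_set (set js) = js"
    by (auto simp: column_choices_def sorted_list_of_set.idem_if_sorted_distinct strict_sorted_iff)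
  show "sorted_list_of_set ` {J. J \<subseteq> {..<n} \<and> card J = k} \<subseteq> column_choices n k"
    using finite_subset[of _ "{..<n}"] by (fastforce simp: column_choices_def)
  show "set ` column_choices n k \<subseteq> {J. J \<subseteq> {..<n} \<and> card J = k}"
    by (auto simp: column_choices_def strict_sorted_iff distinct_card)
qed

text \<open>One row family, taken from the full list \<open>as\<close>, serves all its prefixes, so
  that the sums for \<open>k\<close> and \<open>Suc k\<close> rows can be compared.\<close>

lemma unsigned_incorrelation_take_square:
  assumes "k \<le> length as"
  shows "(unsigned_incorrelation n (take k as))\<^sup>2
       = (\<Sum>J | J \<subseteq> {..<n} \<and> card J = k. (minor (\<lambda>i j. standardized_vec (as ! i) $ j) k J)\<^sup>2)"
proof -
  have sub: "det (standardized_submatrix (take k as) (sorted_list_of_set J))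
      = minor (\<lambda>i j. standardized_vec (as ! i) $ j) k J" for J
    unfolding standardized_submatrix_def minor_def using assms
    by (intro arg_cong[of _ _ det] eq_matI) auto
  have "(unsigned_incorrelation n (take k as))\<^sup>2
      = (\<Sum>js\<in>column_choices n k. (det (standardized_submatrix (take k as) js))\<^sup>2)"
    unfolding unsigned_incorrelation_def using assms by (simp add: sum_nonneg min_absorb2)
  also have "\<dots> = (\<Sum>J | J \<subseteq> {..<n} \<and> card J = k.
      (det (standardized_submatrix (take k as) (sorted_list_of_set J)))\<^sup>2)"
    by (rule sum.reindex_bij_betw[OF bij_betw_column_choices, symmetric])
  finally show ?thesis unfolding sub .
qed

lemma sum_standardized_vec_square_le_1:
  assumes "a \<in> carrier_vec n"
  shows "(\<Sum>j<n. (standardized_vec a $ j)\<^sup>2) \<le> 1"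
proof -
  have dim: "dim_vec (centered_vec a) = n"
    using assms by (simp add: centered_vec_def all_ones_vec_def)
  define s where "s = (\<Sum>j<n. (centered_vec a $ j)\<^sup>2)"
  have "s \<ge> 0" unfolding s_def by (simp add: sum_nonneg)
  have norm: "(euclidean_norm (centered_vec a))\<^sup>2 = s"
    unfolding euclidean_norm_def dim s_def by (simp add: sum_nonneg)
  \<comment> \<open>The quotient stays unevaluated: it is 1 for nonzero \<open>s\<close> and, by the
    convention on division by zero, 0 for \<open>s = 0\<close>.\<close>
  have "(\<Sum>j<n. (standardized_vec a $ j)\<^sup>2) = s / s"
    using dim norm unfolding s_def
    by (simp add: standardized_vec_def power_divide sum_divide_distrib[symmetric] del: divide_self_if)
  then show ?thesis by (simp add: divide_self_if)
qed

lemma unsigned_incorrelation_take_Suc_le: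
  assumes "k < length as" and "as ! k \<in> carrier_vec n"
  shows "(unsigned_incorrelation n (take (Suc k) as))\<^sup>2 \<le> (unsigned_incorrelation n (take k as))\<^sup>2"
proof -
  let ?r = "\<lambda>i j. standardized_vec (as ! i) $ j"
  let ?S = "\<lambda>k. \<Sum>J | J \<subseteq> {..<n} \<and> card J = k. (minor ?r k J)\<^sup>2"
  have "?S (Suc k) \<le> (\<Sum>j<n. (?r k j)\<^sup>2) * ?S k"
    by (rule sum_minor_square_Suc_le) simp
  also have "\<dots> \<le> 1 * ?S k"
    by (intro mult_right_mono sum_standardized_vec_square_le_1 assms sum_nonneg) auto
  finally show ?thesis using assms(1) by (simp add: unsigned_incorrelation_take_square)
qed

lemma unsigned_incorrelation_take_le_1:
  assumes "set as \<subseteq> carrier_vec n" and "k \<le> length as"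
  shows "(unsigned_incorrelation n (take k as))\<^sup>2 \<le> 1"
  using assms(2)
proof (induction k)
  case 0
  \<comment> \<open>The empty family has one choice of columns, and its 0 x 0 determinant is
    1.\<close>
  have "{J. J \<subseteq> {..<n} \<and> card J = 0} = {{}}"
    by (auto dest: finite_subset)
  then show ?case
    unfolding unsigned_incorrelation_take_square[OF 0] by (simp add: minor_def)
next
  case (Suc k)
  then have "as ! k \<in> carrier_vec n" using assms(1) nth_mem[of k as] by auto
  then show ?case using unsigned_incorrelation_take_Suc_le[of k as n] Suc by simp
qed

theorem mainTheorem3:
  fixes m n :: nat and as :: "real vec list"
  assumes "3 \<le> m" and "m \<le> n"
    and "length as = m"
    and "\<And>a. a \<in> set as \<Longrightarrow> a \<in> carrier_vec n"
    and "\<And>a. a \<in> set as \<Longrightarrow> nonzero_variance a"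
  shows "(unsigned_correlation n as)\<^sup>2 \<ge> (unsigned_correlation n (take (m - 1) as))\<^sup>2 \<and>
         (unsigned_incorrelation n as)\<^sup>2 \<le> (unsigned_incorrelation n (take (m - 1) as))\<^sup>2"
proof -
  have carr: "set as \<subseteq> carrier_vec n" using assms(4) by blast
  have m: "Suc (m - 1) = m" "m - 1 < length as" using assms(1,3) by auto
  have mono: "(unsigned_incorrelation n as)\<^sup>2 \<le> (unsigned_incorrelation n (take (m - 1) as))\<^sup>2"
    using unsigned_incorrelation_take_Suc_le[of "m - 1" as n] m assms(3,4) by simp
  \<comment> \<open>Squaring \<open>sqrt x\<close> returns \<open>x\<close> only for nonnegative
    \<open>x\<close>. This bound makes the radicand nonnegative for \<open>m - 1\<close> vectors,
    and \<open>mono\<close> then does so for \<open>m\<close>.\<close>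
  have le1: "(unsigned_incorrelation n (take (m - 1) as))\<^sup>2 \<le> 1"
    using unsigned_incorrelation_take_le_1[OF carr] m(2) by simp
  show ?thesis
    using mono le1 by (simp add: unsigned_correlation_def)
qed

end
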